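(* Let $N\ge1$, let $\Omega\subset\mathbb{R}^N$ be a bounded domain with smooth boundary, and let $p\in(2,\infty)$. For $\sigma\in(0,1)$ let $\lambda_1(\sigma)$ be the first eigenvalue of the fractional Dirichlet Laplacian of order $\sigma$ on $\Omega$, and suppose that $\lambda_1(\sigma)<1$ for all $\sigma\in(0,1)$. For each $\sigma\in(0,1)$, let $u_\sigma$ be a nontrivial weak solution of $$(-\Delta)^\sigma u+|u|^{p-1}\operatorname{sign}u-u=0\ \text{ in }\Omega,\qquad u=0\ \text{ in }\mathbb{R}^N\setminus\Omega.$$ Then $u_\sigma$ converges to zero strongly in $H_0$ as $\sigma\searrow0$.
   Context: $H_0:=\{v\in L^2(\mathbb{R}^N): v=0 \text{ a.e. in }\mathbb{R}^N\setminus\Omega\}$ with the $L^2(\mathbb{R}^N)$ norm. For $r\in(0,1)$, $C(r):=\left(\int_{\mathbb{R}^N}\frac{1-\cos\zeta_1}{|\zeta|^{N+2r}}\,d\zeta\right)^{-1}$, $\mathcal{X}_{r,0}:=\{v\in H^r(\mathbb{R}^N): v=0\text{ a.e. in }\mathbb{R}^N\setminus\Omega\}$ with norm $\|v\|_{\mathcal{X}_{r,0}}^2:=\frac{C(r)}2\iint_{\mathbb{R}^{2N}}\frac{|v(x)-v(y)|^2}{|x-y|^{N+2r}}\,dx\,dy$, and $\lambda_1(r):=\min\{\|v\|_{\mathcal{X}_{r,0}}^2: v\in\mathcal{X}_{r,0},\ \|v\|_{H_0}=1\}$. $\mathcal{E}_\sigma:=\mathcal{X}_{\sigma,0}\cap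 L^p(\mathbb{R}^N)$, $\beta(v):=|v|^{p-1}\operatorname{sign}v$. A function $u\in\mathcal{E}_\sigma$ is a weak solution of the problem if for all $\varphi\in\mathcal{E}_\sigma$ $$\frac{C(\sigma)}2\iint_{\mathbb{R}^{2N}}\frac{(u(x)-u(y))(\varphi(x)-\varphi(y))}{|x-y|^{N+2\sigma}}\,dx\,dy+\int_\Omega\beta(u)\varphi\,dx-\int_\Omega u\varphi\,dx=0.$$ *)

theory Defs
  imports "HOL-Analysis.Analysis"
begin

text \<open>
  The space of dimension \<open>N\<close> is an arbitrary Euclidean space \<open>'a\<close>, with \<open>N = DIM('a)\<close>.
  Elements of the Lebesgue and Sobolev spaces are represented by Lebesgue measurable
  functions rather than by their classes modulo equality almost everywhere.
\<close>

subsection \<open>Bounded domains with smooth boundary\<close>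

primrec Ck :: "nat \<Rightarrow> ('a::euclidean_space \<Rightarrow> real) \<Rightarrow> bool" where
  "Ck 0 f \<longleftrightarrow> continuous_on UNIV f"
| "Ck (Suc k) f \<longleftrightarrow>
     (\<forall>x. f differentiable (at x)) \<and> (\<forall>v. Ck k (\<lambda>x. frechet_derivative f (at x) v))"

definition smooth :: "('a::euclidean_space \<Rightarrow> real) \<Rightarrow> bool" where
  "smooth f \<longleftrightarrow> (\<forall>k. Ck k f)"

text \<open>
  Near each boundary point and in suitable orthonormal coordinates with last axis \<open>e\<close>, the set
  is the region strictly above the graph of a smooth function of the remaining coordinates;
  \<open>x - (x \<bullet> e) *\<^sub>R e\<close> is the projection of \<open>x\<close> to the hyperplane orthogonal to \<open>e\<close>, so only the
  values of \<open>\<gamma>\<close> on that hyperplane matter.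
\<close>

definition smooth_boundary :: "'a::euclidean_space set \<Rightarrow> bool" where
  "smooth_boundary \<Omega> \<longleftrightarrow>
     (\<forall>x0\<in>frontier \<Omega>. \<exists>r>0. \<exists>e. \<exists>\<gamma>. norm e = 1 \<and> smooth \<gamma> \<and>
        \<Omega> \<inter> ball x0 r = {x \<in> ball x0 r. x \<bullet> e > \<gamma> (x - (x \<bullet> e) *\<^sub>R e)})"

definition bounded_smooth_domain :: "'a::euclidean_space set \<Rightarrow> bool" where
  "bounded_smooth_domain \<Omega> \<longleftrightarrow>
     open \<Omega> \<and> connected \<Omega> \<and> \<Omega> \<noteq> {} \<and> bounded \<Omega> \<and> smooth_boundary \<Omega>"

subsection \<open>Function spaces\<close>

definition Lp :: "real \<Rightarrow> ('a::euclidean_space \<Rightarrow> real) set" where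
  "Lp p = {v \<in> borel_measurable lebesgue. integrable lebesgue (\<lambda>x. \<bar>v x\<bar> powr p)}"

definition H0 :: "'a::euclidean_space set \<Rightarrow> ('a \<Rightarrow> real) set" where
  "H0 \<Omega> = {v \<in> Lp 2. AE x in lebesgue. x \<notin> \<Omega> \<longrightarrow> v x = 0}"

definition H0_norm :: "('a::euclidean_space \<Rightarrow> real) \<Rightarrow> real" where
  "H0_norm v = sqrt (\<integral>x. (v x)\<^sup>2 \<partial>lebesgue)"

definition H0_tendsto ::
  "'a::euclidean_space set \<Rightarrow> ('i \<Rightarrow> 'a \<Rightarrow> real) \<Rightarrow> ('a \<Rightarrow> real) \<Rightarrow> 'i filter \<Rightarrow> bool" where
  "H0_tendsto \<Omega> f g F \<longleftrightarrow>
     (\<forall>\<^sub>F s in F. f s \<in> H0 \<Omega>) \<and> g \<in> H0 \<Omega> \<and>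
     ((\<lambda>s. H0_norm (\<lambda>x. f s x - g x)) \<longlongrightarrow> 0) F"

text \<open>
  The integrand of the Gagliardo form. On the diagonal it is \<open>0\<close> by the convention \<open>a / 0 = 0\<close>,
  which is harmless, the diagonal being a null set.
\<close>

definition gagliardo_integrand ::
  "real \<Rightarrow> ('a::euclidean_space \<Rightarrow> real) \<Rightarrow> ('a \<Rightarrow> real) \<Rightarrow> 'a \<times> 'a \<Rightarrow> real" where
  "gagliardo_integrand r u \<phi> =
     (\<lambda>(x, y). (u x - u y) * (\<phi> x - \<phi> y) / norm (x - y) powr (real DIM('a) + 2 * r))"

text \<open>\<open>H\<^sup>r\<close> of the whole space, for \<open>r\<close> in \<open>(0, 1)\<close>.\<close>

definition Hr :: "real \<Rightarrow> ('a::euclidean_space \<Rightarrow> real) set" where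
  "Hr r = {v \<in> Lp 2. integrable (lebesgue \<Otimes>\<^sub>M lebesgue) (gagliardo_integrand r v v)}"

definition X0 :: "'a::euclidean_space set \<Rightarrow> real \<Rightarrow> ('a \<Rightarrow> real) set" where
  "X0 \<Omega> r = {v \<in> Hr r. AE x in lebesgue. x \<notin> \<Omega> \<longrightarrow> v x = 0}"

text \<open>
  A Euclidean space carries no distinguished ordering of its basis, so \<open>\<zeta>\<^sub>1\<close> is the coordinate
  along an arbitrary but fixed basis vector; by rotation invariance of the kernel the integral
  below does not depend on that choice.
\<close>

definition e1 :: "'a::euclidean_space" where
  "e1 = (SOME b. b \<in> Basis)"

definition frac_const :: "'a::euclidean_space itself \<Rightarrow> real \<Rightarrow> real" where
  "frac_const _ r =
     inverse (\<integral>\<zeta>. (1 - cos ((\<zeta>::'a) \<bullet> e1)) / norm \<zeta> powr (real DIM('a) + 2 * r) \<partial>lebesgue)"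

definition X0_form ::
  "real \<Rightarrow> ('a::euclidean_space \<Rightarrow> real) \<Rightarrow> ('a \<Rightarrow> real) \<Rightarrow> real" where
  "X0_form r u \<phi> =
     frac_const TYPE('a) r / 2 *
     (\<integral>z. gagliardo_integrand r u \<phi> z \<partial>(lebesgue \<Otimes>\<^sub>M lebesgue))"

definition X0_norm :: "real \<Rightarrow> ('a::euclidean_space \<Rightarrow> real) \<Rightarrow> real" where
  "X0_norm r v = sqrt (X0_form r v v)"

text \<open>The first eigenvalue, as the minimum (not merely the infimum) of the Rayleigh quotient.\<close>

definition lambda1 :: "'a::euclidean_space set \<Rightarrow> real \<Rightarrow> real" where
  "lambda1 \<Omega> r = (LEAST m. \<exists>v\<in>X0 \<Omega> r. H0_norm v = 1 \<and> m = (X0_norm r v)\<^sup>2)"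

subsection \<open>Weak solutions\<close>

definition E_space :: "'a::euclidean_space set \<Rightarrow> real \<Rightarrow> real \<Rightarrow> ('a \<Rightarrow> real) set" where
  "E_space \<Omega> p \<sigma> = X0 \<Omega> \<sigma> \<inter> Lp p"

definition beta :: "real \<Rightarrow> real \<Rightarrow> real" where
  "beta p t = \<bar>t\<bar> powr (p - 1) * sgn t"

definition weak_solution ::
  "'a::euclidean_space set \<Rightarrow> real \<Rightarrow> real \<Rightarrow> ('a \<Rightarrow> real) \<Rightarrow> bool" where
  "weak_solution \<Omega> p \<sigma> u \<longleftrightarrow>
     u \<in> E_space \<Omega> p \<sigma> \<and>
     (\<forall>\<phi>\<in>E_space \<Omega> p \<sigma>.
        X0_form \<sigma> u \<phi> + (LINT x:\<Omega>|lebesgue. beta p (u x) * \<phi> x)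
          - (LINT x:\<Omega>|lebesgue. u x * \<phi> x) = 0)"

end

theory Submission
  imports Defs
begin

text \<open>
  Testing the equation with \<open>u\<^sub>\<sigma>\<close> itself gives
  \<open>\<parallel>u\<^sub>\<sigma>\<parallel>\<^sup>2 = [u\<^sub>\<sigma>]\<^sup>2 + \<integral> \<bar>u\<^sub>\<sigma>\<bar>\<^sup>p\<close>, where \<open>[\<cdot>]\<close> is the norm of \<open>X\<^bsub>\<sigma>,0\<^esub>\<close>. If \<open>\<Omega>\<close>
  has diameter at most \<open>D\<close>, the pairs with exactly one point in \<open>\<Omega>\<close> alone contribute
  \<open>[v]\<^sup>2 \<ge> C(\<sigma>) T(\<sigma>) \<parallel>v\<parallel>\<^sup>2\<close>, where \<open>T(\<sigma>)\<close> is the integral of \<open>\<bar>z\<bar>\<close> to the power \<open>-N - 2\<sigma>\<close>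
  over \<open>\<bar>z\<bar> > D\<close>. As \<open>\<sigma> \<longlongrightarrow> 0\<close>, \<open>T(\<sigma>)\<close> tends to infinity, whereas the integral defining
  \<open>1 / C(\<sigma>)\<close> differs from \<open>T(\<sigma>)\<close> by a bounded part near the origin and by an oscillating part,
  which is \<open>o(T(\<sigma>))\<close>; so \<open>C(\<sigma>) T(\<sigma>) \<longlongrightarrow> 1\<close>. Hence \<open>\<integral> \<bar>u\<^sub>\<sigma>\<bar>\<^sup>p = o(\<parallel>u\<^sub>\<sigma>\<parallel>\<^sup>2)\<close>, and because \<open>p > 2\<close>
  and \<open>\<Omega>\<close> has finite measure, this forces \<open>u\<^sub>\<sigma> \<longlongrightarrow> 0\<close>.
\<close>

subsection \<open>Radial kernels\<close>

text \<open>Dyadic comparison in place of polar coordinates. On the annulus between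
  \<open>t k / 2\<close> and \<open>t k\<close> the integrand is at most
  \<open>1 / (t k / 2) powr a\<close>, and the annulus lies in a ball of volume proportional to
  \<open>t k ^ DIM('a)\<close>; so the integral is at most a constant times the sum of
  \<open>t k powr (DIM('a) - a)\<close>. The same bound serves near the origin and at
  infinity.\<close>

lemma set_integrable_norm_powr_annuli:
  fixes t :: "nat \<Rightarrow> real" and S :: "'a::euclidean_space set"
  assumes a: "0 \<le> a" and t: "\<And>k. 0 < t k" and S: "S \<in> sets borel"
    and cover: "\<And>z. z \<in> S \<Longrightarrow> \<exists>k. t k / 2 \<le> norm z \<and> norm z \<le> t k"
    and summable: "summable (\<lambda>k. t k powr (real DIM('a) - a))"
  shows "set_integrable lborel S (\<lambda>z. 1 / norm z powr a)"
proof -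
  define c where "c = unit_ball_vol (real DIM('a)) * 2 powr a"
  have c: "c \<ge> 0" by (simp add: c_def)
  have "(\<integral>\<^sup>+z. ennreal (indicator S z *\<^sub>R (1 / norm z powr a)) \<partial>lborel)
      \<le> (\<integral>\<^sup>+z. (\<Sum>k. ennreal (1 / (t k / 2) powr a) * indicator (cball (0::'a) (t k)) z) \<partial>lborel)"
  proof (rule nn_integral_mono)
    fix z :: 'a
    show "ennreal (indicator S z *\<^sub>R (1 / norm z powr a))
      \<le> (\<Sum>k. ennreal (1 / (t k / 2) powr a) * indicator (cball 0 (t k)) z)"
    proof (cases "z \<in> S")
      case True
      then obtain k where k: "t k / 2 \<le> norm z" "norm z \<le> t k" using cover by blast
      have "1 / norm z powr a \<le> 1 / (t k / 2) powr a"
        using k(1) t[of k] a by (intro divide_left_mono powr_mono2) (auto simp: zero_less_mult_iff)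
      then have "ennreal (indicator S z *\<^sub>R (1 / norm z powr a))
          \<le> (\<Sum>j\<in>{k}. ennreal (1 / (t j / 2) powr a) * indicator (cball 0 (t j)) z)"
        using True k(2) by (simp add: ennreal_leI)
      also have "\<dots> \<le> (\<Sum>k. ennreal (1 / (t k / 2) powr a) * indicator (cball 0 (t k)) z)"
        by (rule sum_le_suminf) auto
      finally show ?thesis .
    qed simp
  qed
  also have "\<dots> = (\<Sum>k. \<integral>\<^sup>+z. ennreal (1 / (t k / 2) powr a) * indicator (cball (0::'a) (t k)) z \<partial>lborel)"
    by (intro nn_integral_suminf borel_measurable_times_ennreal borel_measurable_indicator) simp_all
  also have "\<dots> = (\<Sum>k. ennreal (c * t k powr (real DIM('a) - a)))"
  proof (rule suminf_cong)
    fix k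
    have "(\<integral>\<^sup>+z. ennreal (1 / (t k / 2) powr a) * indicator (cball (0::'a) (t k)) z \<partial>lborel)
        = ennreal (1 / (t k / 2) powr a * (unit_ball_vol (real DIM('a)) * t k ^ DIM('a)))"
      using t[of k] by (simp add: nn_integral_cmult_indicator emeasure_cball ennreal_mult[symmetric])
    also have "1 / (t k / 2) powr a * (unit_ball_vol (real DIM('a)) * t k ^ DIM('a))
        = c * t k powr (real DIM('a) - a)"
      using t[of k] by (simp add: c_def powr_divide powr_diff powr_realpow)
    finally show "(\<integral>\<^sup>+z. ennreal (1 / (t k / 2) powr a) * indicator (cball (0::'a) (t k)) z \<partial>lborel)
        = ennreal (c * t k powr (real DIM('a) - a))" .
  qed
  also have "\<dots> = ennreal (\<Sum>k. c * t k powr (real DIM('a) - a))"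
    using c summable by (intro suminf_ennreal2 summable_mult) auto
  also have "\<dots> < \<infinity>" by simp
  finally have fin: "(\<integral>\<^sup>+z. ennreal (indicator S z *\<^sub>R (1 / norm z powr a)) \<partial>lborel) < \<infinity>" .
  show ?thesis
    unfolding set_integrable_def
    by (rule integrableI_bounded) (use S fin in \<open>auto simp del: scaleR_conv_of_real\<close>)
qed

lemma set_integrable_norm_powr_cball:
  fixes R :: real
  assumes "0 \<le> a" "a < real DIM('a::euclidean_space)" "0 < R"
  shows "set_integrable lborel (cball 0 R - {0::'a}) (\<lambda>z. 1 / norm z powr a)"
proof (rule set_integrable_norm_powr_annuli[where t = "\<lambda>k. R * (1/2) ^ k"])
  fix z :: 'a assume z: "z \<in> cball 0 R - {0}"
  \<comment> \<open>\<open>P\<close> fails at 0 and holds for some index, so the index before the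
    least such one gives the annulus containing \<open>z\<close>. This needs \<open>z\<close> to be
    nonzero, which is why the origin is removed.\<close>
  define P where "P = (\<lambda>k. R * (1/2) ^ k < norm z)"
  have ex: "\<exists>k. P k"
  proof -
    have "(\<lambda>k. R * (1/2) ^ k) \<longlonglongrightarrow> R * 0"
      by (intro tendsto_mult tendsto_const LIMSEQ_realpow_zero) auto
    then have "\<forall>\<^sub>F k in sequentially. R * (1/2) ^ k < norm z"
      using z by (intro order_tendstoD) auto
    then show ?thesis unfolding P_def eventually_sequentially by blast
  qed
  have "\<not> P 0" using z by (simp add: P_def)
  then obtain k where "\<not> P k" "P (Suc k)"
    using ex by (metis not0_implies_Suc LeastI_ex not_less_Least lessI)
  then show "\<exists>k. R * (1/2) ^ k / 2 \<le> norm z \<and> norm z \<le> R * (1/2) ^ k"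
    by (intro exI[of _ k]) (auto simp: P_def)
next
  define q where "q = (1/2::real) powr (real DIM('a) - a)"
  have eq: "(R * (1/2) ^ k) powr (real DIM('a) - a) = R powr (real DIM('a) - a) * q ^ k" for k
    using assms by (simp add: q_def powr_mult powr_realpow[symmetric] powr_powr mult.commute)
  have "0 < real DIM('a) - a" using assms by simp
  then have "\<bar>q\<bar> < 1" unfolding q_def using powr_less_mono2[of "real DIM('a) - a" "1/2" 1] by simp
  then show "summable (\<lambda>k. (R * (1/2) ^ k) powr (real DIM('a) - a))"
    unfolding eq by (intro summable_mult summable_geometric) auto
qed (use assms in auto)

lemma set_integrable_norm_powr_tail:
  fixes R :: real
  assumes "real DIM('a::euclidean_space) < a" "0 < R"
  shows "set_integrable lborel {z::'a. R < norm z} (\<lambda>z. 1 / norm z powr a)"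
\<comment> \<open>The extra factor 2 makes the inner radius of annulus \<open>k\<close> equal to
  \<open>R * 2 ^ k\<close>, so that the first annulus starts at \<open>R\<close>.\<close>
proof (rule set_integrable_norm_powr_annuli[where t = "\<lambda>k. 2 * R * 2 ^ k"])
  fix z :: 'a assume z: "z \<in> {z. R < norm z}"
  define P where "P = (\<lambda>k. norm z < R * 2 ^ k)"
  have ex: "\<exists>k. P k"
    using real_arch_pow[of 2 "norm z / R"] assms(2) by (auto simp: P_def field_simps)
  have "\<not> P 0" using z by (simp add: P_def)
  then obtain k where "\<not> P k" "P (Suc k)"
    using ex by (metis not0_implies_Suc LeastI_ex not_less_Least lessI)
  then show "\<exists>k. 2 * R * 2 ^ k / 2 \<le> norm z \<and> norm z \<le> 2 * R * 2 ^ k"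
    by (intro exI[of _ k]) (auto simp: P_def)
next
  define q where "q = (2::real) powr (real DIM('a) - a)"
  have eq: "(2 * R * 2 ^ k) powr (real DIM('a) - a) = (2 * R) powr (real DIM('a) - a) * q ^ k" for k
    using assms by (simp add: q_def powr_mult powr_realpow[symmetric] powr_powr mult.commute)
  have "real DIM('a) - a < 0" using assms by simp
  then have "\<bar>q\<bar> < 1" unfolding q_def using powr_less_mono[of "real DIM('a) - a" 0 2] by simp
  then show "summable (\<lambda>k. (2 * R * 2 ^ k) powr (real DIM('a) - a))"
    unfolding eq by (intro summable_mult summable_geometric) auto
qed (use assms in auto)

text \<open>With \<open>R\<close> bounding the diameter of the domain, its integral is the quantity
  \<open>T\<close> of the overview. The same cut-off radius serves for the normalising constant and
  for the Gagliardo form, so the two diverging masses cancel.\<close>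

definition tail_kernel :: "real \<Rightarrow> real \<Rightarrow> 'a::euclidean_space \<Rightarrow> real" where
  "tail_kernel R r z = (if R < norm z then 1 / norm z powr (real DIM('a) + 2 * r) else 0)"

lemma tail_kernel_measurable [measurable]: "tail_kernel R r \<in> borel_measurable borel"
  unfolding tail_kernel_def by measurable

lemma tail_kernel_nonneg [simp]: "0 \<le> tail_kernel R r z"
  by (simp add: tail_kernel_def)

lemma tail_kernel_le_1: "1 \<le> R \<Longrightarrow> 0 \<le> r \<Longrightarrow> tail_kernel R r z \<le> 1"
  by (auto simp: tail_kernel_def divide_le_eq_1 intro!: ge_one_powr_ge_zero)

lemma integrable_tail_kernel:
  assumes "0 < R" "0 < r"
  shows "integrable lborel (tail_kernel R r :: 'a::euclidean_space \<Rightarrow> real)"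
proof -
  have "tail_kernel R r =
      (\<lambda>z::'a. indicator {z. R < norm z} z *\<^sub>R (1 / norm z powr (real DIM('a) + 2 * r)))"
    by (auto simp: tail_kernel_def fun_eq_iff)
  then show ?thesis
    using set_integrable_norm_powr_tail[where 'a='a, of "real DIM('a) + 2 * r" R] assms
    by (simp add: set_integrable_def)
qed

subsection \<open>The oscillating part of the kernel\<close>

lemma lborel_integral_translation:
  fixes f :: "'a::euclidean_space \<Rightarrow> real"
  assumes [measurable]: "f \<in> borel_measurable borel"
  shows "(\<integral>z. f (w + z) \<partial>lborel) = (\<integral>z. f z \<partial>lborel)"
  using integral_distr[of "(+) w" lborel borel f] by (simp add: lborel_distr_plus)

lemma lborel_integrable_translation:
  fixes f :: "'a::euclidean_space \<Rightarrow> real"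
  assumes "integrable lborel f"
  shows "integrable lborel (\<lambda>z. f (w + z))"
  using assms integrable_distr[of "(+) w" lborel borel f] by (simp add: lborel_distr_plus)

text \<open>Translating by half a period of the cosine changes its sign.\<close>

lemma abs_cos_integral_le_translation:
  fixes f :: "'a::euclidean_space \<Rightarrow> real"
  assumes f: "integrable lborel f" and e: "norm e = 1"
  shows "2 * \<bar>\<integral>z. cos (z \<bullet> e) * f z \<partial>lborel\<bar> \<le> (\<integral>z. \<bar>f z - f (pi *\<^sub>R e + z)\<bar> \<partial>lborel)"
proof -
  have f_meas [measurable]: "f \<in> borel_measurable borel"
    using f by auto
  have cos_int: "integrable lborel (\<lambda>z. cos (z \<bullet> e) * g z)" if g: "integrable lborel g" for g :: "'a \<Rightarrow> real"
  proof (rule Bochner_Integration.integrable_bound[OF g])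
    have [measurable]: "g \<in> borel_measurable borel" using g by auto
    show "(\<lambda>z. cos (z \<bullet> e) * g z) \<in> borel_measurable lborel" by measurable
    show "AE z in lborel. norm (cos (z \<bullet> e) * g z) \<le> norm (g z)"
      by (auto simp: abs_mult intro!: AE_I2 mult_left_le_one_le)
  qed
  have shift: "integrable lborel (\<lambda>z. f (pi *\<^sub>R e + z))"
    by (rule lborel_integrable_translation[OF f])
  have "e \<bullet> e = 1" using e by (simp add: dot_square_norm)
  then have "cos ((pi *\<^sub>R e + z) \<bullet> e) = - cos (z \<bullet> e)" for z
    by (simp add: inner_add_left cos_add)
  then have "(\<integral>z. cos (z \<bullet> e) * f z \<partial>lborel) = - (\<integral>z. cos (z \<bullet> e) * f (pi *\<^sub>R e + z) \<partial>lborel)"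
    using lborel_integral_translation[of "\<lambda>z. cos (z \<bullet> e) * f z" "pi *\<^sub>R e"] by simp
  \<comment> \<open>Adding the two expressions for the integral leaves only the variation of
    \<open>f\<close> under a shift by \<open>pi\<close>, as in the Riemann-Lebesgue lemma.\<close>
  then have "2 * (\<integral>z. cos (z \<bullet> e) * f z \<partial>lborel)
      = (\<integral>z. cos (z \<bullet> e) * (f z - f (pi *\<^sub>R e + z)) \<partial>lborel)"
    using cos_int[OF f] cos_int[OF shift] by (simp add: right_diff_distrib)
  then have "2 * \<bar>\<integral>z. cos (z \<bullet> e) * f z \<partial>lborel\<bar>
      = \<bar>\<integral>z. cos (z \<bullet> e) * (f z - f (pi *\<^sub>R e + z)) \<partial>lborel\<bar>"
    by linarith
  also have "\<dots> \<le> (\<integral>z. \<bar>cos (z \<bullet> e) * (f z - f (pi *\<^sub>R e + z))\<bar> \<partial>lborel)"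
    by (rule integral_abs_bound)
  also have "\<dots> \<le> (\<integral>z. \<bar>f z - f (pi *\<^sub>R e + z)\<bar> \<partial>lborel)"
  proof (rule integral_mono)
    show "integrable lborel (\<lambda>z. \<bar>cos (z \<bullet> e) * (f z - f (pi *\<^sub>R e + z))\<bar>)"
      using cos_int[of "\<lambda>z. f z - f (pi *\<^sub>R e + z)"] f shift by (intro integrable_abs) simp
  qed (use f shift in \<open>auto simp: abs_mult intro!: mult_left_le_one_le\<close>)
  finally show ?thesis .
qed

text \<open>Since \<theta> \<ge> 1, the factor \<open>\<theta> powr a\<close> may be enlarged to
  \<open>\<theta> powr b\<close>; the relative loss is thus uniform over all exponents up to
  \<open>b\<close>.\<close>

lemma inverse_powr_diff_le:
  fixes s t :: real
  assumes "0 < s" "0 < t" "t \<le> \<theta> * s" "1 \<le> \<theta>" "0 \<le> a" "a \<le> b"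
  shows "1 / s powr a - 1 / t powr a \<le> (1 - 1 / \<theta> powr b) * (1 / s powr a)"
proof -
  have "t powr a \<le> \<theta> powr a * s powr a"
    using assms powr_mono2[of a t "\<theta> * s"] by (simp add: powr_mult)
  also have "\<dots> \<le> \<theta> powr b * s powr a"
    using assms by (intro mult_right_mono powr_mono) auto
  finally have "1 / (\<theta> powr b * s powr a) \<le> 1 / t powr a"
    using assms by (intro divide_left_mono) auto
  then show ?thesis by (simp add: diff_divide_distrib)
qed

text \<open>Both \<open>z\<close> and \<open>w + z\<close> have norm above \<open>m\<close>, so
  neither kernel is cut off and the norms differ by a factor of at most
  \<open>1 + norm w / m\<close>. For \<open>r \<le> 1/2\<close> the exponent is at most
  \<open>DIM('a) + 1\<close>, which makes the bound uniform in \<open>r\<close>.\<close>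

lemma tail_kernel_shift_le:
  fixes w z :: "'a::euclidean_space"
  assumes R: "1 \<le> R" and r: "0 < r" "r \<le> 1/2" and m: "R \<le> m"
    and z: "m + norm w < norm z"
  shows "\<bar>tail_kernel R r z - tail_kernel R r (w + z)\<bar>
    \<le> (1 - 1 / (1 + norm w / m) powr (real DIM('a) + 1)) * (tail_kernel R r z + tail_kernel R r (w + z))"
proof -
  define \<theta> where "\<theta> = 1 + norm w / m"
  define N where "N = real DIM('a)"
  define \<epsilon> where "\<epsilon> = 1 - 1 / \<theta> powr (N + 1)"
  have m0: "m > 0" using R m by simp
  have \<theta>: "1 \<le> \<theta>" using m0 by (simp add: \<theta>_def)
  have \<epsilon>: "0 \<le> \<epsilon>" using \<theta> by (auto simp: \<epsilon>_def divide_le_eq_1 N_def intro!: ge_one_powr_ge_zero)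
  have wz: "m < norm (w + z)" using z norm_triangle_ineq4[of "w + z" w] by simp
  have z': "m < norm z" using z norm_ge_zero[of w] by linarith
  \<comment> \<open>Turns the additive error of the triangle inequality into a multiplicative
    one.\<close>
  have le: "norm w \<le> norm w / m * norm y" if "m < norm y" for y :: 'a
    using that m0 mult_left_mono[of m "norm y" "norm w"] by (simp add: pos_le_divide_eq mult.commute)
  have 1: "norm (w + z) \<le> \<theta> * norm z"
    using norm_triangle_ineq[of w z] le[OF z'] by (simp add: \<theta>_def distrib_right)
  have 2: "norm z \<le> \<theta> * norm (w + z)"
    using norm_triangle_ineq4[of "w + z" w] le[OF wz] by (simp add: \<theta>_def distrib_right)
  define k l where "k = tail_kernel R r z" and "l = tail_kernel R r (w + z)"
  have kl: "k = 1 / norm z powr (N + 2 * r)" "l = 1 / norm (w + z) powr (N + 2 * r)"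
    using z' wz m by (auto simp: k_def l_def tail_kernel_def N_def)
  have pos: "0 < norm z" "0 < norm (w + z)" using z' wz m0 by linarith+
  have exps: "0 \<le> N + 2 * r" "N + 2 * r \<le> N + 1" using r by (simp_all add: N_def)
  have "k - l \<le> \<epsilon> * k" "l - k \<le> \<epsilon> * l"
    unfolding kl \<epsilon>_def
    using inverse_powr_diff_le[OF pos(1,2) 1 \<theta> exps] inverse_powr_diff_le[OF pos(2,1) 2 \<theta> exps] .
  moreover have "0 \<le> \<epsilon> * k" "0 \<le> \<epsilon> * l" using \<epsilon> by (simp_all add: k_def l_def)
  ultimately have "\<bar>k - l\<bar> \<le> \<epsilon> * (k + l)" by (simp add: distrib_left abs_le_iff)
  then show ?thesis by (simp add: k_def l_def \<epsilon>_def \<theta>_def N_def)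
qed

text \<open>A Riemann-Lebesgue estimate uniform in \<open>r\<close>. After the half-period shift,
  the kernel difference is at most 1 on a fixed ball and relatively small outside it. The point is
  that \<open>M\<close>, the volume of that ball, does not depend on \<open>r\<close>.\<close>

lemma cos_tail_kernel_bound:
  fixes e :: "'a::euclidean_space"
  assumes e: "norm e = 1" and R: "1 \<le> R" and \<epsilon>: "0 < \<epsilon>"
  shows "\<exists>M. \<forall>r. 0 < r \<and> r \<le> 1/2 \<longrightarrow>
    \<bar>\<integral>z. cos (z \<bullet> e) * tail_kernel R r z \<partial>lborel\<bar> \<le> M + \<epsilon> * (\<integral>z. tail_kernel R r (z::'a) \<partial>lborel)"
proof -
  have "((\<lambda>m. 1 - 1 / (1 + pi / m) powr (real DIM('a) + 1)) \<longlongrightarrow> 1 - 1 / (1 + 0) powr (real DIM('a) + 1)) at_top"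
    by (intro tendsto_intros tendsto_divide_0[OF tendsto_const] filterlim_at_top_imp_at_infinity filterlim_ident) auto
  then have "\<forall>\<^sub>F m in at_top. 1 - 1 / (1 + pi / m) powr (real DIM('a) + 1) < \<epsilon>"
    using \<epsilon> by (intro order_tendstoD) auto
  then have "\<forall>\<^sub>F m in at_top. 1 - 1 / (1 + pi / m) powr (real DIM('a) + 1) < \<epsilon> \<and> R \<le> m"
    using eventually_ge_at_top[of R] by eventually_elim auto
  \<comment> \<open>Beyond radius \<open>m + pi\<close>, a shift of length \<open>pi\<close> changes
    the kernel by a relative amount below \<epsilon>.\<close>
  then obtain m where m: "1 - 1 / (1 + pi / m) powr (real DIM('a) + 1) < \<epsilon>" "R \<le> m"
    unfolding eventually_at_top_linorder by blast
  define B where "B = cball (0::'a) (m + pi)"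
  show ?thesis
  proof (intro exI[of _ "measure lborel B"] allI impI)
    fix r :: real assume r: "0 < r \<and> r \<le> 1/2"
    define K where "K = (tail_kernel R r :: 'a \<Rightarrow> real)"
    have K: "integrable lborel K"
      unfolding K_def using R r by (intro integrable_tail_kernel) auto
    have K': "integrable lborel (\<lambda>z. K (pi *\<^sub>R e + z))"
      by (rule lborel_integrable_translation[OF K])
    have [measurable]: "K \<in> borel_measurable borel" by (simp add: K_def)
    have B: "integrable lborel (indicator B :: 'a \<Rightarrow> real)"
      using emeasure_lborel_cball_finite[of "0::'a" "m + pi"]
      by (intro integrable_real_indicator) (auto simp: B_def)
    have "\<bar>K z - K (pi *\<^sub>R e + z)\<bar> \<le> indicator B z + \<epsilon> * (K z + K (pi *\<^sub>R e + z))" for z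
    proof (cases "z \<in> B")
      case True
      have "0 \<le> \<epsilon> * (K z + K (pi *\<^sub>R e + z))" using \<epsilon> by (simp add: K_def)
      moreover have "\<bar>K z - K (pi *\<^sub>R e + z)\<bar> \<le> 1"
        using tail_kernel_le_1[of R r z] tail_kernel_le_1[of R r "pi *\<^sub>R e + z"]
          tail_kernel_nonneg[of R r z] tail_kernel_nonneg[of R r "pi *\<^sub>R e + z"] R r
        unfolding K_def abs_le_iff by linarith
      ultimately show ?thesis using True by simp
    next
      case False
      then have "\<bar>K z - K (pi *\<^sub>R e + z)\<bar> \<le> (1 - 1 / (1 + pi / m) powr (real DIM('a) + 1)) * (K z + K (pi *\<^sub>R e + z))"
        using tail_kernel_shift_le[of R r m "pi *\<^sub>R e" z] R r m e by (simp add: B_def K_def)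
      also have "\<dots> \<le> \<epsilon> * (K z + K (pi *\<^sub>R e + z))"
        using m by (intro mult_right_mono) (auto simp: K_def)
      finally show ?thesis using False by simp
    qed
    then have "(\<integral>z. \<bar>K z - K (pi *\<^sub>R e + z)\<bar> \<partial>lborel)
        \<le> (\<integral>z. indicator B z + \<epsilon> * (K z + K (pi *\<^sub>R e + z)) \<partial>lborel)"
      using K K' B by (intro integral_mono Bochner_Integration.integrable_add) auto
    \<comment> \<open>The kernel and its translate have the same integral; the resulting 2 is
      absorbed by the 2 gained from the shift.\<close>
    also have "\<dots> = measure lborel B + 2 * \<epsilon> * (\<integral>z. K z \<partial>lborel)"
      using K K' B lborel_integral_translation[of K "pi *\<^sub>R e"] by simp
    finally have "2 * \<bar>\<integral>z. cos (z \<bullet> e) * K z \<partial>lborel\<bar> \<le> measure lborel B + 2 * \<epsilon> * (\<integral>z. K z \<partial>lborel)"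
      using abs_cos_integral_le_translation[OF K e] by linarith
    then show "\<bar>\<integral>z. cos (z \<bullet> e) * tail_kernel R r z \<partial>lborel\<bar>
        \<le> measure lborel B + \<epsilon> * (\<integral>z. tail_kernel R r (z::'a) \<partial>lborel)"
      using measure_nonneg[of lborel B] unfolding K_def by linarith
  qed
qed

section \<open>Divergence of the tail integral as \<open>r\<close> tends to 0\<close>

lemma filterlim_tail_kernel_integral:
  fixes R :: real
  assumes R: "1 \<le> R"
  shows "filterlim (\<lambda>r. \<integral>z. tail_kernel R r (z::'a::euclidean_space) \<partial>lborel) at_top (at_right 0)"
  unfolding filterlim_at_top
proof
  fix Z :: real
  \<comment> \<open>At \<open>r = 0\<close> every dyadic shell has the same lower bound
    \<open>c\<close> for its mass, whence divergence. Finitely many shells already exceed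
    \<open>Z\<close>, and on these the kernel is close to its limit for small
    \<open>r\<close>.\<close>
  define N where "N = real DIM('a)"
  define t where "t = (\<lambda>k::nat. R * 2 ^ k)"
  define E where "E = (\<lambda>k. cball (0::'a) (t (Suc k)) - cball 0 (t k))"
  define c where "c = unit_ball_vol N * (1 - 1 / 2 powr N)"
  have t_pos: "0 < t k" for k using R by (simp add: t_def)
  have "1 < 2 powr N" by (simp add: N_def)
  then have c: "0 < c" by (simp add: c_def N_def)
  \<comment> \<open>Half of \<open>c\<close> is given up to pay for the factor
    \<open>t (Suc k) powr (- 2 * r)\<close>.\<close>
  obtain n where n: "Z < real n * (c / 2)"
    using reals_Archimedean3[of "c / 2"] c by auto
  have shell_disj: "E j \<inter> E k = {}" if "j < k" for j k
  proof -
    have "t (Suc j) \<le> t k" using R that by (simp add: t_def power_increasing del: power_Suc)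
    then show ?thesis by (auto simp: E_def)
  qed
  have disj: "disjoint_family_on E {..<n}"
    unfolding disjoint_family_on_def using shell_disj by (metis Int_commute linorder_neqE_nat)
  have meas_E: "measure lborel (E k) = c * t (Suc k) powr N" for k
  proof -
    have "measure lborel (E k) = measure lborel (cball (0::'a) (t (Suc k))) - measure lborel (cball (0::'a) (t k))"
      unfolding E_def using t_pos[of k] emeasure_lborel_cball_finite[of "0::'a" "t (Suc k)"]
      by (intro measure_Diff subset_cball) (auto simp: t_def)
    also have "\<dots> = unit_ball_vol N * t (Suc k) ^ DIM('a) - unit_ball_vol N * t k ^ DIM('a)"
      using t_pos[of k] t_pos[of "Suc k"] by (simp add: content_cball N_def)
    also have "\<dots> = c * t (Suc k) powr N"
      using t_pos[of k] t_pos[of "Suc k"]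
      by (simp add: c_def N_def powr_realpow t_def power_mult_distrib field_simps)
    finally show ?thesis .
  qed
  \<comment> \<open>\<open>t n\<close> is the outermost radius among the \<open>n\<close> shells,
    where this factor is smallest; controlling it there controls it on all of them.\<close>
  have "((\<lambda>r. t n powr (- 2 * r)) \<longlongrightarrow> t n powr (- 2 * 0)) (at_right 0)"
    using t_pos[of n] by (intro tendsto_intros) auto
  then have "\<forall>\<^sub>F r in at_right 0. 1 / 2 < t n powr (- 2 * r)"
    using t_pos[of n] by (intro order_tendstoD) auto
  then show "\<forall>\<^sub>F r in at_right 0. Z \<le> (\<integral>z. tail_kernel R r (z::'a) \<partial>lborel)"
    using eventually_at_right_less[of 0]
  proof eventually_elim
    case (elim r)
    have int: "integrable lborel (\<lambda>z. indicator (E k) z * (1 / t (Suc k) powr (N + 2 * r)))" for k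
      using emeasure_lborel_cball_finite[of "0::'a" "t (Suc k)"]
      by (intro integrable_mult_left integrable_real_indicator)
        (auto simp: E_def intro!: le_less_trans[OF emeasure_mono[OF Diff_subset]])
    have "real n * (c / 2) = (\<Sum>k<n. c / 2)" by simp
    also have "\<dots> \<le> (\<Sum>k<n. measure lborel (E k) * (1 / t (Suc k) powr (N + 2 * r)))"
    proof (rule sum_mono)
      fix k assume k: "k \<in> {..<n}"
      have "t (Suc k) \<le> t n" using R k by (simp add: t_def power_increasing del: power_Suc)
      then have "t n powr (- 2 * r) \<le> t (Suc k) powr (- 2 * r)"
        using t_pos[of "Suc k"] elim by (intro powr_mono2') auto
      then have "c / 2 \<le> c * t (Suc k) powr (- 2 * r)" using elim c by simp
      also have "\<dots> = measure lborel (E k) * (1 / t (Suc k) powr (N + 2 * r))"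
        using t_pos[of "Suc k"] by (simp add: meas_E powr_add powr_minus divide_simps)
      finally show "c / 2 \<le> measure lborel (E k) * (1 / t (Suc k) powr (N + 2 * r))" .
    qed
    also have "\<dots> = (\<integral>z. (\<Sum>k<n. indicator (E k) z * (1 / t (Suc k) powr (N + 2 * r))) \<partial>lborel)"
      using int by (subst Bochner_Integration.integral_sum) (auto simp: E_def)
    also have "\<dots> \<le> (\<integral>z. tail_kernel R r (z::'a) \<partial>lborel)"
    proof (rule integral_mono)
      fix z :: 'a
      show "(\<Sum>k<n. indicator (E k) z * (1 / t (Suc k) powr (N + 2 * r))) \<le> tail_kernel R r z"
      proof (cases "z \<in> (\<Union>k<n. E k)")
        case True
        then obtain k where k: "k < n" "z \<in> E k" by blast
        have "(\<Sum>k<n. indicator (E k) z * (1 / t (Suc k) powr (N + 2 * r))) = 1 / t (Suc k) powr (N + 2 * r)"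
          using sum_indicator_disjoint_family[OF disj, of z k "\<lambda>k. 1 / t (Suc k) powr (N + 2 * r)"] k
          by (simp add: mult.commute)
        moreover have "R \<le> t k" using R by (simp add: t_def)
        moreover have "1 / t (Suc k) powr (N + 2 * r) \<le> 1 / norm z powr (N + 2 * r)"
          using k t_pos[of k] t_pos[of "Suc k"] elim
          by (intro divide_left_mono powr_mono2 mult_pos_pos) (auto simp: E_def N_def)
        ultimately show ?thesis using k by (auto simp: tail_kernel_def N_def E_def)
      next
        case False
        then show ?thesis by (auto intro!: order_trans[OF eq_refl[OF sum.neutral]])
      qed
    qed (use int R elim in \<open>auto intro!: integrable_tail_kernel Bochner_Integration.integrable_sum\<close>)
    finally show ?case using n by linarith
  qed
qed

subsection \<open>Asymptotics of the normalising constant\<close>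

lemma norm_e1 [simp]: "norm (e1 :: 'a::euclidean_space) = 1"
proof -
  have "(e1 :: 'a) \<in> Basis" by (simp add: e1_def some_in_eq)
  then show ?thesis by simp
qed

lemma one_minus_cos_le_square: "1 - cos (x::real) \<le> x\<^sup>2"
proof -
  have "1 - cos x = 2 * (sin (x / 2))\<^sup>2" using cos_double_sin[of "x / 2"] by simp
  moreover have "(sin (x / 2))\<^sup>2 \<le> (x / 2)\<^sup>2" by (rule abs_le_square_iff[THEN iffD1, OF abs_sin_x_le_abs_x])
  ultimately show ?thesis using zero_le_power2[of "sin (x / 2)"] by (simp only: power_divide power2_eq_square[of "2::real"])
qed

text \<open>Quadratic vanishing of \<open>1 - cos\<close> gains two powers of \<open>norm z\<close>.
  One is spent on lowering the singularity to the integrable order \<open>DIM('a) - 1\<close>; what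
  remains is \<open>norm z powr (1 - 2 * r)\<close>, which is at most \<open>R\<close> because
  \<open>r \<le> 1/2\<close>. The majorant is free of \<open>r\<close>.\<close>

lemma near_kernel_le:
  fixes e z :: "'a::euclidean_space"
  assumes e: "norm e = 1" and R: "1 \<le> R" and r: "0 < r" "r \<le> 1/2" and z: "norm z \<le> R" "z \<noteq> 0"
  shows "(1 - cos (z \<bullet> e)) / norm z powr (real DIM('a) + 2 * r) \<le> R * (1 / norm z powr (real DIM('a) - 1))"
proof -
  have "\<bar>z \<bullet> e\<bar> \<le> norm z" using Cauchy_Schwarz_ineq2[of z e] e by simp
  then have "(z \<bullet> e)\<^sup>2 \<le> (norm z)\<^sup>2" by (simp add: abs_le_square_iff[symmetric])
  then have "1 - cos (z \<bullet> e) \<le> norm z powr 2"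
    using one_minus_cos_le_square[of "z \<bullet> e"] z by simp
  then have "(1 - cos (z \<bullet> e)) / norm z powr (real DIM('a) + 2 * r) \<le> norm z powr 2 / norm z powr (real DIM('a) + 2 * r)"
    by (intro divide_right_mono) auto
  also have "\<dots> = norm z powr (2 - (real DIM('a) + 2 * r))"
    by (simp only: powr_diff)
  also have "2 - (real DIM('a) + 2 * r) = (1 - 2 * r) - (real DIM('a) - 1)"
    by simp
  also have "norm z powr \<dots> = norm z powr (1 - 2 * r) * (1 / norm z powr (real DIM('a) - 1))"
    by (simp only: powr_diff times_divide_eq_right mult_1_right)
  also have "\<dots> \<le> R * (1 / norm z powr (real DIM('a) - 1))"
  proof (intro mult_right_mono)
    have "norm z powr (1 - 2 * r) \<le> R powr (1 - 2 * r)" using z r by (intro powr_mono2) auto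
    also have "\<dots> \<le> R powr 1" using R r by (intro powr_mono) auto
    finally show "norm z powr (1 - 2 * r) \<le> R" using R by simp
  qed simp
  finally show ?thesis .
qed

lemma near_kernel_integral:
  fixes e :: "'a::euclidean_space"
  assumes e: "norm e = 1" and R: "1 \<le> R"
  shows "\<exists>M. \<forall>r. 0 < r \<and> r \<le> 1/2 \<longrightarrow>
    set_integrable lborel (cball 0 R) (\<lambda>z. (1 - cos (z \<bullet> e)) / norm z powr (real DIM('a) + 2 * r)) \<and>
    \<bar>LINT z:cball 0 R|lborel. (1 - cos (z \<bullet> e)) / norm z powr (real DIM('a) + 2 * r)\<bar> \<le> M"
proof -
  define h where "h = (\<lambda>z::'a. indicator (cball 0 R - {0}) z *\<^sub>R (1 / norm z powr (real DIM('a) - 1)))"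
  have "integrable lborel h"
    using set_integrable_norm_powr_cball[where 'a='a, of "real DIM('a) - 1" R] R
    by (simp add: h_def set_integrable_def DIM_positive Suc_leI)
  then have h: "integrable lborel (\<lambda>z. R * h z)" by simp
  show ?thesis
  proof (intro exI[of _ "\<integral>z. R * h z \<partial>lborel"] allI impI)
    fix r :: real assume r: "0 < r \<and> r \<le> 1/2"
    let ?g = "\<lambda>z::'a. (1 - cos (z \<bullet> e)) / norm z powr (real DIM('a) + 2 * r)"
    define k where "k = (\<lambda>z. indicator (cball 0 R) z *\<^sub>R ?g z)"
    \<comment> \<open>At the origin both sides are 0: the numerator \<open>1 - cos 0\<close>
      vanishes and \<open>h\<close> leaves the point out.\<close>
    have bound: "norm (k z) \<le> R * h z" for z
      using near_kernel_le[OF e R, of r z] r R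
      by (cases "z = 0") (auto simp: k_def h_def indicator_def)
    have "k \<in> borel_measurable borel" unfolding k_def
      by (intro borel_measurable_scaleR borel_measurable_indicator) (simp, measurable)
    then have k: "integrable lborel k"
      using bound h by (intro Bochner_Integration.integrable_bound[OF h]) (auto intro!: AE_I2 order_trans[OF _ abs_ge_self])
    moreover have "\<bar>\<integral>z. k z \<partial>lborel\<bar> \<le> (\<integral>z. R * h z \<partial>lborel)"
      using k h bound
      by (intro order_trans[OF integral_abs_bound] integral_mono integrable_abs) auto
    ultimately show "set_integrable lborel (cball 0 R) ?g \<and>
        \<bar>LINT z:cball 0 R|lborel. ?g z\<bar> \<le> (\<integral>z. R * h z \<partial>lborel)"
      by (simp add: set_integrable_def set_lebesgue_integral_def k_def)
  qed
qed

lemma frac_const_nonneg: "0 \<le> frac_const TYPE('a::euclidean_space) r"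
  unfolding frac_const_def by (simp add: Bochner_Integration.integral_nonneg)

lemma frac_const_integral_split:
  fixes e :: "'a::euclidean_space"
  assumes R: "1 \<le> R" and r: "0 < r"
    and near: "set_integrable lborel (cball 0 R) (\<lambda>z. (1 - cos (z \<bullet> e)) / norm z powr (real DIM('a) + 2 * r))"
  shows "(\<integral>z. (1 - cos (z \<bullet> e)) / norm z powr (real DIM('a) + 2 * r) \<partial>lborel) =
    (LINT z:cball 0 R|lborel. (1 - cos (z \<bullet> e)) / norm z powr (real DIM('a) + 2 * r))
    + (\<integral>z. tail_kernel R r (z::'a) \<partial>lborel) - (\<integral>z. cos (z \<bullet> e) * tail_kernel R r z \<partial>lborel)"
proof -
  let ?g = "\<lambda>z::'a. (1 - cos (z \<bullet> e)) / norm z powr (real DIM('a) + 2 * r)"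
  have K: "integrable lborel (tail_kernel R r :: 'a \<Rightarrow> real)"
    using R r by (intro integrable_tail_kernel) auto
  have cosK: "integrable lborel (\<lambda>z::'a. cos (z \<bullet> e) * tail_kernel R r z)"
    by (rule Bochner_Integration.integrable_bound[OF K])
      (auto simp: abs_mult intro!: AE_I2 mult_left_le_one_le)
  have "?g = (\<lambda>z. indicator (cball 0 R) z *\<^sub>R ?g z + tail_kernel R r z - cos (z \<bullet> e) * tail_kernel R r z)"
    by (auto simp: tail_kernel_def fun_eq_iff diff_divide_distrib)
  then have "(\<integral>z. ?g z \<partial>lborel) =
      (\<integral>z. indicator (cball 0 R) z *\<^sub>R ?g z + tail_kernel R r z - cos (z \<bullet> e) * tail_kernel R r z \<partial>lborel)"
    by (rule arg_cong)
  also have "\<dots> = (LINT z:cball 0 R|lborel. ?g z) + (\<integral>z. tail_kernel R r (z::'a) \<partial>lborel)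
      - (\<integral>z. cos (z \<bullet> e) * tail_kernel R r z \<partial>lborel)"
    unfolding set_lebesgue_integral_def
    using near[unfolded set_integrable_def] K cosK
    by (simp only: Bochner_Integration.integral_diff Bochner_Integration.integral_add
      Bochner_Integration.integrable_add)
  finally show ?thesis .
qed

text \<open>The reciprocal of the constant is the near part plus the tail mass minus the oscillating
  part. Divided by the diverging tail mass, the first tends to 0 because it is bounded, the last by
  the uniform oscillation estimate.\<close>

lemma frac_const_tail_tendsto:
  fixes R :: real
  assumes R: "1 \<le> R"
  shows "((\<lambda>r. frac_const TYPE('a::euclidean_space) r * (\<integral>z. tail_kernel R r (z::'a) \<partial>lborel)) \<longlongrightarrow> 1) (at_right 0)"
proof -
  define T where "T r = (\<integral>z. tail_kernel R r (z::'a) \<partial>lborel)" for r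
  define I where "I r = (\<integral>z. (1 - cos ((z::'a) \<bullet> e1)) / norm z powr (real DIM('a) + 2 * r) \<partial>lborel)" for r
  have T: "filterlim T at_top (at_right 0)"
    using filterlim_tail_kernel_integral[OF R, where 'a='a] by (simp add: T_def[abs_def])
  obtain M where M: "\<And>r. 0 < r \<Longrightarrow> r \<le> 1/2 \<Longrightarrow>
    set_integrable lborel (cball 0 R) (\<lambda>z. (1 - cos ((z::'a) \<bullet> e1)) / norm z powr (real DIM('a) + 2 * r)) \<and>
    \<bar>LINT z:cball 0 R|lborel. (1 - cos ((z::'a) \<bullet> e1)) / norm z powr (real DIM('a) + 2 * r)\<bar> \<le> M"
    using near_kernel_integral[where 'a='a, of e1 R] R by auto
  have "((\<lambda>r. I r / T r) \<longlongrightarrow> 1) (at_right 0)"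
  proof (rule tendstoI)
    fix \<epsilon> :: real assume \<epsilon>: "0 < \<epsilon>"
    obtain M' where M': "\<And>r. 0 < r \<Longrightarrow> r \<le> 1/2 \<Longrightarrow>
        \<bar>\<integral>z. cos ((z::'a) \<bullet> e1) * tail_kernel R r z \<partial>lborel\<bar> \<le> M' + \<epsilon> / 2 * T r"
      using cos_tail_kernel_bound[where 'a='a, of e1 R "\<epsilon> / 2"] R \<epsilon> by (auto simp: T_def)
    have "\<forall>\<^sub>F r in at_right (0::real). r \<in> {0<..<1/2}" by (rule eventually_at_right_real) simp
    then show "\<forall>\<^sub>F r in at_right 0. dist (I r / T r) 1 < \<epsilon>"
      \<comment> \<open>The second entry pushes \<open>M + M'\<close> below
        \<open>\<epsilon> / 2 * T r\<close>; the entry 0 makes \<open>T r\<close> positive, so that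
        one may divide by it.\<close>
      using filterlim_at_top_dense[THEN iffD1, OF T, rule_format, of "max 0 (2 * (M + M') / \<epsilon>)"]
    proof eventually_elim
      case (elim r)
      have "\<bar>I r - T r\<bar> \<le> M + M' + \<epsilon> / 2 * T r"
        using M[of r] M'[of r] frac_const_integral_split[OF R, of r "e1::'a"] elim
        by (simp add: I_def T_def abs_le_iff)
      also have "\<dots> < \<epsilon> * T r" using elim \<epsilon> by (simp add: field_simps)
      finally show ?case using elim by (simp add: dist_real_def abs_less_iff field_simps)
    qed
  qed
  then have "((\<lambda>r. inverse (I r / T r)) \<longlongrightarrow> inverse 1) (at_right 0)"
    by (rule tendsto_inverse) simp
  \<comment> \<open>The integrand is Borel, so its integrals over \<open>lebesgue\<close> and
    \<open>lborel\<close> agree.\<close>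
  moreover have "frac_const TYPE('a) r = inverse (I r)" for r
    unfolding frac_const_def I_def by (subst integral_completion) auto
  ultimately show ?thesis by (simp add: T_def[symmetric] field_simps)
qed

subsection \<open>A lower bound for the Gagliardo form\<close>

text \<open>Makes Tonelli available on the product of two completed measures.\<close>

lemma sigma_finite_lebesgue: "sigma_finite_measure (lebesgue :: 'a::euclidean_space measure)"
proof
  obtain A :: "'a set set" where A: "countable A" "A \<subseteq> sets lborel" "\<Union>A = space lborel"
    "\<forall>a\<in>A. emeasure lborel a \<noteq> \<infinity>"
    using lborel.sigma_finite_countable by blast
  then show "\<exists>A::'a set set. countable A \<and> A \<subseteq> sets lebesgue \<and> \<Union>A = space lebesgue \<and> (\<forall>a\<in>A. emeasure lebesgue a \<noteq> \<infinity>)"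
    by (intro exI[of _ A]) (auto simp: emeasure_completion)
qed

lemma nn_integral_tail_kernel_translation:
  fixes x :: "'a::euclidean_space"
  assumes "0 < R" "0 < r"
  shows "(\<integral>\<^sup>+y. ennreal (tail_kernel R r (x - y)) \<partial>lebesgue) = ennreal (\<integral>z. tail_kernel R r (z::'a) \<partial>lborel)"
proof -
  have "tail_kernel R r (x - y) = tail_kernel R r (- x + y)" for y
    by (simp add: tail_kernel_def norm_minus_commute[of x y])
  then have "(\<integral>\<^sup>+y. ennreal (tail_kernel R r (x - y)) \<partial>lebesgue) = (\<integral>\<^sup>+y. ennreal (tail_kernel R r (- x + y)) \<partial>lborel)"
    by (simp add: nn_integral_completion)
  also have "\<dots> = (\<integral>\<^sup>+y. ennreal (tail_kernel R r y) \<partial>distr lborel borel ((+) (- x)))"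
    by (subst nn_integral_distr) auto
  also have "\<dots> = (\<integral>\<^sup>+y. ennreal (tail_kernel R r (y::'a)) \<partial>lborel)"
    by (simp only: lborel_distr_plus)
  also have "\<dots> = ennreal (\<integral>z. tail_kernel R r (z::'a) \<partial>lborel)"
    using integrable_tail_kernel[OF assms, where 'a='a] by (intro nn_integral_eq_integral) auto
  finally show ?thesis .
qed

lemma gagliardo_integrand_nonneg [simp]: "0 \<le> gagliardo_integrand r v v z"
  by (auto simp: gagliardo_integrand_def split: prod.split)

lemma gagliardo_integrand_commute: "gagliardo_integrand r v v (x, y) = gagliardo_integrand r v v (y, x)"
  by (simp add: gagliardo_integrand_def norm_minus_commute algebra_simps)

text \<open>A point at distance more than \<open>D\<close> from \<open>x\<close> is outside the
  domain, where \<open>v\<close> vanishes almost everywhere; there the integrand is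
  \<open>(v x)\<^sup>2\<close> times the kernel. By translation invariance the mass of the kernel is
  the same for every \<open>x\<close>.\<close>

lemma nn_integral_gagliardo_outside_ge:
  fixes \<Omega> :: "'a::euclidean_space set"
  assumes v: "v \<in> borel_measurable lebesgue" "AE x in lebesgue. x \<notin> \<Omega> \<longrightarrow> v x = 0"
    and D: "\<And>x y. x \<in> \<Omega> \<Longrightarrow> y \<in> \<Omega> \<Longrightarrow> norm (x - y) \<le> D" "0 < D" and r: "0 < r" and x: "x \<in> \<Omega>"
  shows "ennreal ((v x)\<^sup>2) * ennreal (\<integral>z. tail_kernel D r (z::'a) \<partial>lborel)
    \<le> (\<integral>\<^sup>+y. ennreal (gagliardo_integrand r v v (x, y)) * indicator (- \<Omega>) y \<partial>lebesgue)"
proof -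
  have "(\<lambda>y. tail_kernel D r (x - y)) \<in> borel_measurable lborel" by measurable
  then have "(\<lambda>y. tail_kernel D r (x - y)) \<in> borel_measurable lebesgue"
    by (rule measurable_completion)
  then have "ennreal ((v x)\<^sup>2) * ennreal (\<integral>z. tail_kernel D r (z::'a) \<partial>lborel)
      = (\<integral>\<^sup>+y. ennreal ((v x)\<^sup>2) * ennreal (tail_kernel D r (x - y)) \<partial>lebesgue)"
    by (subst nn_integral_cmult) (auto simp: nn_integral_tail_kernel_translation[OF D(2) r])
  also have "\<dots> \<le> (\<integral>\<^sup>+y. ennreal (gagliardo_integrand r v v (x, y)) * indicator (- \<Omega>) y \<partial>lebesgue)"
  proof (rule nn_integral_mono_AE)
    show "AE y in lebesgue. ennreal ((v x)\<^sup>2) * ennreal (tail_kernel D r (x - y))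
        \<le> ennreal (gagliardo_integrand r v v (x, y)) * indicator (- \<Omega>) y"
      using v(2)
    proof eventually_elim
      case (elim y)
      show ?case
      proof (cases "D < norm (x - y)")
        case True
        then have "y \<notin> \<Omega>" using D(1)[OF x] by force
        with True elim show ?thesis
          by (simp add: tail_kernel_def gagliardo_integrand_def power2_eq_square ennreal_mult[symmetric])
      qed (simp add: tail_kernel_def)
    qed
  qed
  finally show ?thesis .
qed

text \<open>A Poincare inequality whose constant tends to 1 as \<open>r\<close> tends to 0. The sets
  \<open>\<Omega> \<times> (- \<Omega>)\<close> and \<open>(- \<Omega>) \<times> \<Omega>\<close>
  are disjoint mirror images with equal contributions; their sum cancels the factor 1/2 of the
  form.\<close>

lemma X0_form_ge:
  fixes \<Omega> :: "'a::euclidean_space set"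
  assumes v: "v \<in> X0 \<Omega> r" and \<Omega>: "\<Omega> \<in> sets lebesgue"
    and D: "\<And>x y. x \<in> \<Omega> \<Longrightarrow> y \<in> \<Omega> \<Longrightarrow> norm (x - y) \<le> D" "0 < D" and r: "0 < r"
  shows "frac_const TYPE('a) r * (\<integral>z. tail_kernel D r (z::'a) \<partial>lborel) * (\<integral>x. (v x)\<^sup>2 \<partial>lebesgue) \<le> X0_form r v v"
proof -
  interpret leb: sigma_finite_measure "lebesgue :: 'a measure" by (rule sigma_finite_lebesgue)
  interpret pair_sigma_finite "lebesgue :: 'a measure" "lebesgue :: 'a measure" ..
  define T where "T = (\<integral>z. tail_kernel D r (z::'a) \<partial>lborel)"
  define G where "G = (\<lambda>z. ennreal (gagliardo_integrand r v v z))"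
  have T: "0 \<le> T" by (simp add: T_def)
  have v_meas [measurable]: "v \<in> borel_measurable lebesgue" and v0: "AE x in lebesgue. x \<notin> \<Omega> \<longrightarrow> v x = 0"
    and v2: "integrable lebesgue (\<lambda>x. (v x)\<^sup>2)"
    and g: "integrable (lebesgue \<Otimes>\<^sub>M lebesgue) (gagliardo_integrand r v v)"
    using v by (auto simp: X0_def Hr_def Lp_def)
  have [measurable]: "gagliardo_integrand r v v \<in> borel_measurable (lebesgue \<Otimes>\<^sub>M lebesgue)"
    using g by auto
  then have G [measurable]: "G \<in> borel_measurable (lebesgue \<Otimes>\<^sub>M lebesgue)"
    unfolding G_def by measurable
  have \<Omega>' [measurable]: "\<Omega> \<in> sets lebesgue" "- \<Omega> \<in> sets lebesgue"
    using \<Omega> by (auto simp: Compl_in_sets_lebesgue)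
  have half: "ennreal (T * (\<integral>x. (v x)\<^sup>2 \<partial>lebesgue))
      \<le> (\<integral>\<^sup>+x. (\<integral>\<^sup>+y. ennreal (gagliardo_integrand r v v (x, y)) * indicator (- \<Omega>) y \<partial>lebesgue) * indicator \<Omega> x \<partial>lebesgue)"
  proof -
    have "ennreal (T * (\<integral>x. (v x)\<^sup>2 \<partial>lebesgue)) = ennreal T * (\<integral>\<^sup>+x. ennreal ((v x)\<^sup>2) \<partial>lebesgue)"
      using v2 T by (subst nn_integral_eq_integral) (auto simp: ennreal_mult)
    also have "\<dots> = (\<integral>\<^sup>+x. ennreal ((v x)\<^sup>2) * ennreal T \<partial>lebesgue)"
      by (subst nn_integral_multc) (auto simp: mult.commute)
    also have "\<dots> \<le> (\<integral>\<^sup>+x. (\<integral>\<^sup>+y. ennreal (gagliardo_integrand r v v (x, y)) * indicator (- \<Omega>) y \<partial>lebesgue) * indicator \<Omega> x \<partial>lebesgue)"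
    proof (rule nn_integral_mono_AE)
      show "AE x in lebesgue. ennreal ((v x)\<^sup>2) * ennreal T
          \<le> (\<integral>\<^sup>+y. ennreal (gagliardo_integrand r v v (x, y)) * indicator (- \<Omega>) y \<partial>lebesgue) * indicator \<Omega> x"
        using v0
      proof eventually_elim
        case (elim x)
        then show ?case
          using nn_integral_gagliardo_outside_ge[OF v_meas v0 D r, of x]
          by (cases "x \<in> \<Omega>") (auto simp: T_def)
      qed
    qed
    finally show ?thesis .
  qed
  have fst: "(\<integral>\<^sup>+z. G z * indicator (\<Omega> \<times> (- \<Omega>)) z \<partial>(lebesgue \<Otimes>\<^sub>M lebesgue))
      = (\<integral>\<^sup>+x. (\<integral>\<^sup>+y. G (x, y) * indicator (- \<Omega>) y \<partial>lebesgue) * indicator \<Omega> x \<partial>lebesgue)"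
  proof -
    have "(\<integral>\<^sup>+z. G z * indicator (\<Omega> \<times> (- \<Omega>)) z \<partial>(lebesgue \<Otimes>\<^sub>M lebesgue))
        = (\<integral>\<^sup>+x. (\<integral>\<^sup>+y. G (x, y) * indicator (\<Omega> \<times> (- \<Omega>)) (x, y) \<partial>lebesgue) \<partial>lebesgue)"
      by (subst leb.nn_integral_fst[symmetric]) auto
    also have "\<dots> = (\<integral>\<^sup>+x. (\<integral>\<^sup>+y. G (x, y) * indicator (- \<Omega>) y \<partial>lebesgue) * indicator \<Omega> x \<partial>lebesgue)"
      by (intro nn_integral_cong) (auto simp: indicator_times split: split_indicator)
    finally show ?thesis .
  qed
  \<comment> \<open>Integrating in the opposite order and using the symmetry of the integrand gives
    the same iterated integral as for the first product.\<close>
  have snd: "(\<integral>\<^sup>+z. G z * indicator ((- \<Omega>) \<times> \<Omega>) z \<partial>(lebesgue \<Otimes>\<^sub>M lebesgue))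
      = (\<integral>\<^sup>+x. (\<integral>\<^sup>+y. G (x, y) * indicator (- \<Omega>) y \<partial>lebesgue) * indicator \<Omega> x \<partial>lebesgue)"
  proof -
    have "(\<integral>\<^sup>+z. G z * indicator ((- \<Omega>) \<times> \<Omega>) z \<partial>(lebesgue \<Otimes>\<^sub>M lebesgue))
        = (\<integral>\<^sup>+x. (\<integral>\<^sup>+y. G (y, x) * indicator ((- \<Omega>) \<times> \<Omega>) (y, x) \<partial>lebesgue) \<partial>lebesgue)"
      by (subst nn_integral_snd[symmetric]) auto
    also have "\<dots> = (\<integral>\<^sup>+x. (\<integral>\<^sup>+y. G (x, y) * indicator (- \<Omega>) y \<partial>lebesgue) * indicator \<Omega> x \<partial>lebesgue)"
      using gagliardo_integrand_commute[of r v]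
      by (intro nn_integral_cong) (auto simp: G_def indicator_times split: split_indicator)
    finally show ?thesis .
  qed
  define s where "s = T * (\<integral>x. (v x)\<^sup>2 \<partial>lebesgue)"
  have s: "0 \<le> s" using T by (simp add: s_def)
  have "ennreal (2 * s) = ennreal s + ennreal s"
    using s by (simp add: ennreal_plus[symmetric] del: ennreal_plus)
  also have "\<dots> \<le> (\<integral>\<^sup>+z. G z * indicator (\<Omega> \<times> (- \<Omega>)) z \<partial>(lebesgue \<Otimes>\<^sub>M lebesgue))
      + (\<integral>\<^sup>+z. G z * indicator ((- \<Omega>) \<times> \<Omega>) z \<partial>(lebesgue \<Otimes>\<^sub>M lebesgue))"
    unfolding fst snd using half unfolding s_def G_def by (intro add_mono)
  also have "\<dots> = (\<integral>\<^sup>+z. G z * indicator (\<Omega> \<times> (- \<Omega>)) z + G z * indicator ((- \<Omega>) \<times> \<Omega>) z \<partial>(lebesgue \<Otimes>\<^sub>M lebesgue))"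
    by (subst nn_integral_add) auto
  also have "\<dots> \<le> (\<integral>\<^sup>+z. G z \<partial>(lebesgue \<Otimes>\<^sub>M lebesgue))"
    by (intro nn_integral_mono) (auto split: split_indicator)
  also have "\<dots> = ennreal (\<integral>z. gagliardo_integrand r v v z \<partial>(lebesgue \<Otimes>\<^sub>M lebesgue))"
    unfolding G_def using g by (intro nn_integral_eq_integral) auto
  finally have "2 * s \<le> (\<integral>z. gagliardo_integrand r v v z \<partial>(lebesgue \<Otimes>\<^sub>M lebesgue))"
    by (subst (asm) ennreal_le_iff) (auto intro!: Bochner_Integration.integral_nonneg)
  then have "frac_const TYPE('a) r / 2 * (2 * s) \<le> X0_form r v v"
    unfolding X0_form_def using frac_const_nonneg[where 'a='a] by (intro mult_left_mono) auto
  then show ?thesis by (simp add: s_def T_def mult.assoc)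
qed

subsection \<open>Convergence of the solutions\<close>

text \<open>Replaces Hoelder's inequality: values up to \<delta> are covered by the first term, and
  beyond \<delta> the negative power \<open>2 - p\<close> of \<open>\<bar>t\<bar>\<close> is at most
  that of \<delta>.\<close>

lemma square_le_powr_split:
  fixes t \<delta> p :: real
  assumes "0 < \<delta>" "2 < p"
  shows "t\<^sup>2 \<le> \<delta>\<^sup>2 + \<delta> powr (2 - p) * \<bar>t\<bar> powr p"
proof (cases "\<bar>t\<bar> \<le> \<delta>")
  case True
  then have "\<bar>t\<bar>\<^sup>2 \<le> \<delta>\<^sup>2" by (intro power_mono) auto
  then show ?thesis by (simp add: add_increasing2)
next
  case False
  then have "t\<^sup>2 = \<bar>t\<bar> powr (2 - p) * \<bar>t\<bar> powr p"
    using assms by (simp add: powr_add[symmetric])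
  also have "\<dots> \<le> \<delta> powr (2 - p) * \<bar>t\<bar> powr p"
    using False assms by (intro mult_right_mono powr_mono2') auto
  finally show ?thesis by (simp add: add_increasing)
qed

lemma beta_mult_self: "1 < p \<Longrightarrow> beta p t * t = \<bar>t\<bar> powr p"
  by (cases "t = 0") (auto simp: beta_def powr_diff sgn_if abs_if)

lemma weak_solution_energy:
  assumes u: "weak_solution \<Omega> p \<sigma> u" and p: "1 < p" and \<Omega>: "\<Omega> \<in> sets lebesgue"
  shows "X0_form \<sigma> u u + (\<integral>x. \<bar>u x\<bar> powr p \<partial>lebesgue) = (\<integral>x. (u x)\<^sup>2 \<partial>lebesgue)"
proof -
  have uE: "u \<in> E_space \<Omega> p \<sigma>" using u by (simp add: weak_solution_def)
  then have [measurable]: "u \<in> borel_measurable lebesgue" and u0: "AE x in lebesgue. x \<notin> \<Omega> \<longrightarrow> u x = 0"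
    by (auto simp: E_space_def X0_def Lp_def)
  note [measurable] = \<Omega>
  have "(LINT x:\<Omega>|lebesgue. beta p (u x) * u x) = (\<integral>x. \<bar>u x\<bar> powr p \<partial>lebesgue)"
    unfolding set_lebesgue_integral_def beta_mult_self[OF p]
  proof (rule integral_cong_AE)
    show "AE x in lebesgue. indicat_real \<Omega> x *\<^sub>R (\<bar>u x\<bar> powr p) = \<bar>u x\<bar> powr p"
      using u0 by eventually_elim (auto split: split_indicator)
  qed measurable
  moreover have "(LINT x:\<Omega>|lebesgue. u x * u x) = (\<integral>x. (u x)\<^sup>2 \<partial>lebesgue)"
    unfolding set_lebesgue_integral_def power2_eq_square
  proof (rule integral_cong_AE)
    show "AE x in lebesgue. indicat_real \<Omega> x *\<^sub>R (u x * u x) = u x * u x"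
      using u0 by eventually_elim (auto split: split_indicator)
  qed measurable
  moreover have "X0_form \<sigma> u u + (LINT x:\<Omega>|lebesgue. beta p (u x) * u x) - (LINT x:\<Omega>|lebesgue. u x * u x) = 0"
    using u uE by (simp add: weak_solution_def)
  ultimately show ?thesis by simp
qed

text \<open>The constant term of the pointwise splitting is charged only on \<open>\<Omega>\<close>,
  since \<open>v\<close> vanishes almost everywhere elsewhere; so it contributes a finite
  amount.\<close>

lemma integral_square_le_powr:
  fixes v :: "'a::euclidean_space \<Rightarrow> real"
  assumes v: "v \<in> H0 \<Omega>" "v \<in> Lp p" and \<Omega>: "\<Omega> \<in> lmeasurable" and \<delta>: "0 < \<delta>" and p: "2 < p"
  shows "(\<integral>x. (v x)\<^sup>2 \<partial>lebesgue) \<le> \<delta>\<^sup>2 * measure lebesgue \<Omega> + \<delta> powr (2 - p) * (\<integral>x. \<bar>v x\<bar> powr p \<partial>lebesgue)"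
proof -
  have v2: "integrable lebesgue (\<lambda>x. (v x)\<^sup>2)" and vp: "integrable lebesgue (\<lambda>x. \<bar>v x\<bar> powr p)"
    and v0: "AE x in lebesgue. x \<notin> \<Omega> \<longrightarrow> v x = 0"
    using v by (auto simp: H0_def Lp_def)
  have ind: "integrable lebesgue (\<lambda>x. \<delta>\<^sup>2 * indicator \<Omega> x)"
    using \<Omega> by (intro integrable_mult_right) (auto simp: fmeasurable_def)
  have "(\<integral>x. (v x)\<^sup>2 \<partial>lebesgue) \<le> (\<integral>x. \<delta>\<^sup>2 * indicator \<Omega> x + \<delta> powr (2 - p) * \<bar>v x\<bar> powr p \<partial>lebesgue)"
  proof (rule integral_mono_AE)
    show "AE x in lebesgue. (v x)\<^sup>2 \<le> \<delta>\<^sup>2 * indicator \<Omega> x + \<delta> powr (2 - p) * \<bar>v x\<bar> powr p"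
      using v0 by eventually_elim (auto simp: square_le_powr_split[OF \<delta> p] split: split_indicator)
  qed (use v2 vp ind in auto)
  also have "\<dots> = \<delta>\<^sup>2 * measure lebesgue \<Omega> + \<delta> powr (2 - p) * (\<integral>x. \<bar>v x\<bar> powr p \<partial>lebesgue)"
    using vp ind by simp
  finally show ?thesis .
qed

theorem proposition6p2:
  fixes \<Omega> :: "'a::euclidean_space set" and p :: real and u :: "real \<Rightarrow> 'a \<Rightarrow> real"
  assumes "bounded_smooth_domain \<Omega>"
    and "p > 2"
    and "\<And>\<sigma>. \<sigma> \<in> {0<..<1} \<Longrightarrow> lambda1 \<Omega> \<sigma> < 1"
    and "\<And>\<sigma>. \<sigma> \<in> {0<..<1} \<Longrightarrow> weak_solution \<Omega> p \<sigma> (u \<sigma>)"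
    and "\<And>\<sigma>. \<sigma> \<in> {0<..<1} \<Longrightarrow> \<not> (AE x in lebesgue. u \<sigma> x = 0)"
  shows "H0_tendsto \<Omega> u (\<lambda>x. 0) (at_right 0)"
proof -
  have "open \<Omega>" "bounded \<Omega>"
    using assms(1) by (auto simp: bounded_smooth_domain_def)
  then have \<Omega>: "\<Omega> \<in> lmeasurable" by (rule lmeasurable_open[rotated])
  then have \<Omega>_sets: "\<Omega> \<in> sets lebesgue" by (rule fmeasurableD)
  obtain B where B: "\<And>x. x \<in> \<Omega> \<Longrightarrow> norm x \<le> B"
    using \<open>bounded \<Omega>\<close> by (auto simp: bounded_iff)
  \<comment> \<open>\<open>2 * B\<close> bounds the diameter; the 1 meets the condition on the
    cut-off radius in the asymptotics of the constant.\<close>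
  define D where "D = max 1 (2 * B)"
  have D: "norm (x - y) \<le> D" if "x \<in> \<Omega>" "y \<in> \<Omega>" for x y
    using norm_triangle_ineq4[of x y] B[OF that(1)] B[OF that(2)] by (simp add: D_def)
  have D1: "1 \<le> D" by (simp add: D_def)
  define c where "c \<sigma> = frac_const TYPE('a) \<sigma> * (\<integral>z. tail_kernel D \<sigma> (z::'a) \<partial>lborel)" for \<sigma>
  define n where "n \<sigma> = (\<integral>x. (u \<sigma> x)\<^sup>2 \<partial>lebesgue)" for \<sigma>
  have c: "(c \<longlongrightarrow> 1) (at_right 0)"
    using frac_const_tail_tendsto[OF D1, where 'a='a] by (simp add: c_def[abs_def])
  have ev: "\<forall>\<^sub>F \<sigma> in at_right 0. \<sigma> \<in> {0<..<1::real}"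
    by (rule eventually_at_right_real) simp
  have space: "u \<sigma> \<in> X0 \<Omega> \<sigma>" "u \<sigma> \<in> Lp p" "u \<sigma> \<in> H0 \<Omega>" if "\<sigma> \<in> {0<..<1}" for \<sigma>
    using assms(4)[OF that] by (auto simp: weak_solution_def E_space_def X0_def Hr_def H0_def)
  \<comment> \<open>The energy identity and the lower bound for the form leave at most
    \<open>(1 - c \<sigma>) * n \<sigma>\<close> for the integral of the \<open>p\<close>-th
    power.\<close>
  have n_le: "n \<sigma> \<le> \<delta>\<^sup>2 * measure lebesgue \<Omega> + \<delta> powr (2 - p) * ((1 - c \<sigma>) * n \<sigma>)"
    if "\<sigma> \<in> {0<..<1}" "0 < \<delta>" for \<sigma> \<delta>
  proof -
    have "c \<sigma> * n \<sigma> \<le> X0_form \<sigma> (u \<sigma>) (u \<sigma>)"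
      unfolding c_def n_def using X0_form_ge[OF space(1)[OF that(1)] \<Omega>_sets D] D1 that by auto
    then have "(\<integral>x. \<bar>u \<sigma> x\<bar> powr p \<partial>lebesgue) \<le> (1 - c \<sigma>) * n \<sigma>"
      using weak_solution_energy[OF assms(4)[OF that(1)] _ \<Omega>_sets] assms(2)
      by (simp add: n_def left_diff_distrib)
    then have "\<delta> powr (2 - p) * (\<integral>x. \<bar>u \<sigma> x\<bar> powr p \<partial>lebesgue) \<le> \<delta> powr (2 - p) * ((1 - c \<sigma>) * n \<sigma>)"
      by (rule mult_left_mono) simp
    then show ?thesis
      using integral_square_le_powr[OF space(3,2)[OF that(1)] \<Omega> that(2) assms(2)] by (simp add: n_def)
  qed
  have n_nonneg: "0 \<le> n \<sigma>" for \<sigma> by (simp add: n_def)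
  have "(n \<longlongrightarrow> 0) (at_right 0)"
  proof (rule tendstoI)
    fix \<epsilon> :: real assume \<epsilon>: "0 < \<epsilon>"
    define m where "m = measure lebesgue \<Omega>"
    \<comment> \<open>Chosen so that \<open>2 * (\<delta>\<^sup>2 * m)\<close> equals
      \<open>\<epsilon> * m / (m + 1)\<close>, strictly below \<epsilon>.\<close>
    define \<delta> where "\<delta> = sqrt (\<epsilon> / (2 * (m + 1)))"
    have m: "0 \<le> m" by (simp add: m_def)
    have \<delta>: "0 < \<delta>" "2 * (\<delta>\<^sup>2 * m) < \<epsilon>"
      using \<epsilon> m by (auto simp: \<delta>_def field_simps)
    \<comment> \<open>With \<delta> fixed, the coefficient of \<open>n \<sigma>\<close> on the right
      of \<open>n_le\<close> falls below 1/2 for small \<sigma>, and that term is absorbed on the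
      left.\<close>
    have "((\<lambda>\<sigma>. \<delta> powr (2 - p) * (1 - c \<sigma>)) \<longlongrightarrow> \<delta> powr (2 - p) * (1 - 1)) (at_right 0)"
      by (intro tendsto_intros c)
    then have "\<forall>\<^sub>F \<sigma> in at_right 0. \<delta> powr (2 - p) * (1 - c \<sigma>) < 1 / 2"
      by (intro order_tendstoD) auto
    then show "\<forall>\<^sub>F \<sigma> in at_right 0. dist (n \<sigma>) 0 < \<epsilon>"
      using ev
    proof eventually_elim
      case (elim \<sigma>)
      have "\<delta> powr (2 - p) * (1 - c \<sigma>) * n \<sigma> \<le> 1 / 2 * n \<sigma>"
        using elim n_nonneg by (intro mult_right_mono) auto
      then have "n \<sigma> \<le> 2 * (\<delta>\<^sup>2 * m)"
        using n_le[OF elim(2) \<delta>(1)] unfolding m_def mult.assoc by linarith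
      then show ?case using \<delta>(2) n_nonneg[of \<sigma>] by simp
    qed
  qed
  then have "((\<lambda>\<sigma>. sqrt (n \<sigma>)) \<longlongrightarrow> sqrt 0) (at_right 0)"
    by (rule tendsto_real_sqrt)
  moreover have "\<forall>\<^sub>F \<sigma> in at_right 0. u \<sigma> \<in> H0 \<Omega>"
    using ev by eventually_elim (rule space)
  ultimately show ?thesis
    by (simp add: H0_tendsto_def H0_norm_def n_def H0_def Lp_def)
qed

end
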